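(* For any $d$-dimensional 0-1 matrix $P$ with no more than three $1$-entries, $\operatorname{ex}(n,P,d)=O(n^{d-1})$.
   Context: A $d$-dimensional 0-1 matrix $A$ contains a $d$-dimensional 0-1 matrix $P$ if $A$ has a submatrix (obtained by restricting each of the $d$ coordinates to a subset of its range) of the same dimensions as $P$ that can be turned into $P$ by changing any number of $1$-entries to $0$-entries; otherwise $A$ avoids $P$ (is $P$-free). $\operatorname{ex}(n,P,d)$ is the maximum possible number of $1$-entries in a $P$-free $d$-dimensional 0-1 matrix of dimensions $n\times n\times\dots\times n$ (taken to be $0$ if no such matrix exists). Asymptotics are for $n\to\infty$ with $P$ and $d$ fixed. *)

theory Defs
  imports Complex_Main "HOL-Library.FuncSet" "HOL-Library.Landau_Symbols"
begin

text \<open>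
  Coordinates are numbered \<open>0, \<dots>, d - 1\<close>, and each coordinate \<open>i\<close> ranges over
  \<open>0, \<dots>, k i - 1\<close>, where \<open>k\<close> is the vector of dimensions of the matrix. Only the values of
  \<open>k\<close> on \<open>{..<d}\<close> matter. Positions and matrices are extensional functions.
\<close>

definition positions :: "nat \<Rightarrow> (nat \<Rightarrow> nat) \<Rightarrow> (nat \<Rightarrow> nat) set" where
  "positions d k = (\<Pi>\<^sub>E i\<in>{..<d}. {..<k i})"

definition zero_one_matrices :: "nat \<Rightarrow> (nat \<Rightarrow> nat) \<Rightarrow> ((nat \<Rightarrow> nat) \<Rightarrow> nat) set" where
  "zero_one_matrices d k = (\<Pi>\<^sub>E x\<in>positions d k. {0, 1})"

definition num_ones :: "nat \<Rightarrow> (nat \<Rightarrow> nat) \<Rightarrow> ((nat \<Rightarrow> nat) \<Rightarrow> nat) \<Rightarrow> nat" where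
  "num_ones d k A = card {x \<in> positions d k. A x = 1}"

text \<open>
  Restricting coordinate \<open>i\<close> to the finite set \<open>S i\<close>: the remaining values are renumbered
  in increasing order, so the result has dimensions \<open>card (S i)\<close>.
\<close>

definition submatrix ::
  "nat \<Rightarrow> (nat \<Rightarrow> nat set) \<Rightarrow> ((nat \<Rightarrow> nat) \<Rightarrow> nat) \<Rightarrow> (nat \<Rightarrow> nat) \<Rightarrow> nat" where
  "submatrix d S A =
     (\<lambda>x\<in>positions d (\<lambda>i. card (S i)). A (\<lambda>i\<in>{..<d}. sorted_list_of_set (S i) ! x i))"

text \<open>
  \<open>contains d m A k P\<close>: the matrix \<open>A\<close> of dimensions \<open>m\<close> contains the matrix \<open>P\<close> of
  dimensions \<open>k\<close>.
\<close>

definition contains ::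
  "nat \<Rightarrow> (nat \<Rightarrow> nat) \<Rightarrow> ((nat \<Rightarrow> nat) \<Rightarrow> nat) \<Rightarrow> (nat \<Rightarrow> nat) \<Rightarrow> ((nat \<Rightarrow> nat) \<Rightarrow> nat) \<Rightarrow> bool" where
  "contains d m A k P \<longleftrightarrow>
     (\<exists>S. (\<forall>i<d. S i \<subseteq> {..<m i} \<and> card (S i) = k i) \<and>
          (\<forall>x\<in>positions d k.
             submatrix d S A x = P x \<or> submatrix d S A x = 1 \<and> P x = 0))"

definition extremal_number ::
  "nat \<Rightarrow> (nat \<Rightarrow> nat) \<Rightarrow> ((nat \<Rightarrow> nat) \<Rightarrow> nat) \<Rightarrow> nat \<Rightarrow> nat" where
  "extremal_number d k P n =
     (let W = {num_ones d (\<lambda>_. n) A | A.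
                 A \<in> zero_one_matrices d (\<lambda>_. n) \<and> \<not> contains d (\<lambda>_. n) A k P}
      in if W = {} then 0 else Max W)"

end

theory Submission imports Defs begin

text \<open>
  Write the ones of \<open>P\<close> as \<open>p 0, p 1, p 2\<close> and let \<open>c\<close> be their coordinatewise median. In each
  coordinate, at most one of the three points lies strictly above \<open>c\<close> and at most one strictly
  below, so three points obtained from a common point \<open>m\<close> by moving arbitrary (but large) distances
  in the directions \<open>sgn (p j - c)\<close> have the right relative order, with large gaps. The points of a
  set \<open>B\<close> in the cube from which no point of \<open>B\<close> is far away in a given direction number only
  \<open>O(n ^ (d - 1))\<close>, since each line in that direction has boundedly many of them. Hence a denser
  matrix has a one \<open>m\<close> from which all three directions lead to further ones. The point \<open>c\<close>
  need not be a one of \<open>P\<close>.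
\<close>

lemma finite_positions: "finite (positions d k)"
  unfolding positions_def by (intro finite_PiE) auto

lemma zero_one_matricesD:
  "A \<in> zero_one_matrices d k \<Longrightarrow> x \<in> positions d k \<Longrightarrow> A x = 0 \<or> A x = 1"
  unfolding zero_one_matrices_def by (drule PiE_mem) auto

section \<open>Monotone embeddings and containment\<close>

text \<open>Before the first prescribed point \<open>f\<close> is the identity; after that it climbs
  with slope 1 from the last prescribed point at or below the argument. For arguments below
  \<open>k\<close> it climbs by less than \<open>k\<close>, so it cannot reach the next prescribed
  value. The lower margin leaves room for the identity piece, the upper one for the final
  climb.\<close>

lemma strict_mono_on_extension:
  fixes a b :: "'j \<Rightarrow> nat"
  assumes J: "finite J" "J \<noteq> {}"
    and eq: "\<And>j l. j \<in> J \<Longrightarrow> l \<in> J \<Longrightarrow> a j = a l \<Longrightarrow> b j = b l"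
    and gap: "\<And>j l. j \<in> J \<Longrightarrow> l \<in> J \<Longrightarrow> a j < a l \<Longrightarrow> b j + k \<le> b l"
    and margin: "\<And>j. j \<in> J \<Longrightarrow> k \<le> b j \<and> b j + k \<le> n"
  obtains f where "strict_mono_on {..<k} f" "f ` {..<k} \<subseteq> {..<n}" "\<And>j. j \<in> J \<Longrightarrow> f (a j) = b j"
proof -
  define Q where "Q x = {y \<in> a ` J. y \<le> x}" for x
  define g where "g y = b (inv_into J a y)" for y
  define f where "f x = (if Q x = {} then x else g (Max (Q x)) + (x - Max (Q x)))" for x
  \<comment> \<open>\<open>inv_into\<close> may return another index with the same value of
    \<open>a\<close>; by \<open>eq\<close> this does not change \<open>b\<close>.\<close>
  have g: "g (a j) = b j" if "j \<in> J" for j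
    unfolding g_def using that by (intro eq) (auto simp: inv_into_into f_inv_into_f)
  have Qfin: "finite (Q x)" for x
    unfolding Q_def using J by auto
  have Qmax: "Max (Q x) \<in> a ` J" "Max (Q x) \<le> x" if "Q x \<noteq> {}" for x
    using Max_in[OF Qfin that] unfolding Q_def by auto
  have gm: "k \<le> g y" "g y + k \<le> n" if "y \<in> a ` J" for y
    using that margin g by auto
  have gg: "g y + k \<le> g z" if "y \<in> a ` J" "z \<in> a ` J" "y < z" for y z
    using that gap g by auto
  have "k \<le> n" using J margin by fastforce
  have "strict_mono_on {..<k} f"
  proof (rule strict_mono_onI)
    fix x y assume xy: "x \<in> {..<k}" "y \<in> {..<k}" "x < y"
    have sub: "Q x \<subseteq> Q y" using xy unfolding Q_def by auto
    show "f x < f y"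
    proof (cases "Q x = {}")
      case True
      show ?thesis
      proof (cases "Q y = {}")
        case False
        then show ?thesis using gm(1)[OF Qmax(1)[OF False]] xy True by (simp add: f_def)
      qed (use True xy in \<open>simp add: f_def\<close>)
    next
      case False
      then have Fy: "Q y \<noteq> {}" using sub by auto
      have le: "Max (Q x) \<le> Max (Q y)" using sub False Qfin by (intro Max_mono) auto
      show ?thesis
      proof (cases "Max (Q x) = Max (Q y)")
        case True
        then show ?thesis using xy False Fy Qmax(2)[OF False] by (simp add: f_def)
      next
        case ne: False
        then have "g (Max (Q x)) + k \<le> g (Max (Q y))"
          using le by (intro gg Qmax False Fy) auto
        then show ?thesis using xy False Fy by (simp add: f_def)
      qed
    qed
  qed
  moreover have "f x < n" if "x < k" for x
  proof (cases "Q x = {}")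
    case False
    then show ?thesis using gm(2)[OF Qmax(1)[OF False]] that by (simp add: f_def)
  qed (use that \<open>k \<le> n\<close> in \<open>simp add: f_def\<close>)
  moreover have "f (a j) = b j" if "j \<in> J" for j
  proof -
    have "Max (Q (a j)) = a j"
      using that Qfin by (intro Max_eqI) (auto simp: Q_def)
    moreover have "Q (a j) \<noteq> {}" using that by (auto simp: Q_def)
    ultimately show ?thesis using g[OF that] by (simp add: f_def)
  qed
  ultimately show ?thesis by (intro that[of f]) auto
qed

lemma sorted_list_of_set_image_strict_mono_on:
  fixes f :: "nat \<Rightarrow> nat"
  assumes "strict_mono_on {..<k} f"
  shows "sorted_list_of_set (f ` {..<k}) = map f [0..<k]"
proof -
  have "sorted_wrt (<) (map f [0..<k])"
    using assms by (auto simp: sorted_wrt_iff_nth_less strict_mono_on_def)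
  moreover have "set (map f [0..<k]) = f ` {..<k}" by auto
  ultimately show ?thesis
    using sorted_list_of_set.idem_if_sorted_distinct[of "map f [0..<k]"]
    by (simp add: strict_sorted_iff)
qed

text \<open>With the images of the \<open>f i\<close> as coordinate sets, the \<open>x i\<close>-th
  chosen value is \<open>f i (x i)\<close>, so \<open>submatrix\<close> reads \<open>A\<close> at
  the image of \<open>x\<close>. Where \<open>P\<close> is 0, either entry of \<open>A\<close> is
  acceptable, so only the ones remain to be checked.\<close>

lemma containsI:
  assumes mono: "\<And>i. i < d \<Longrightarrow> strict_mono_on {..<k i} (f i)"
    and range: "\<And>i. i < d \<Longrightarrow> f i ` {..<k i} \<subseteq> {..<m i}"
    and A: "A \<in> zero_one_matrices d m" and P: "P \<in> zero_one_matrices d k"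
    and ones: "\<And>x. x \<in> positions d k \<Longrightarrow> P x = 1 \<Longrightarrow> A (\<lambda>i\<in>{..<d}. f i (x i)) = 1"
  shows "contains d m A k P"
  unfolding contains_def
proof (intro exI[of _ "\<lambda>i. f i ` {..<k i}"] conjI allI impI ballI)
  have card: "card (f i ` {..<k i}) = k i" if "i < d" for i
    using strict_mono_on_imp_inj_on[OF mono[OF that]] by (simp add: card_image)
  fix x assume x: "x \<in> positions d k"
  then have xk: "x i < k i" if "i < d" for i
    using that by (auto simp: positions_def)
  have "x \<in> positions d (\<lambda>i. card (f i ` {..<k i}))"
    using x card by (auto simp: positions_def PiE_iff)
  moreover have "(\<lambda>i\<in>{..<d}. sorted_list_of_set (f i ` {..<k i}) ! x i) = (\<lambda>i\<in>{..<d}. f i (x i))"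
    using xk by (intro restrict_ext) (simp add: sorted_list_of_set_image_strict_mono_on mono)
  ultimately have sub: "submatrix d (\<lambda>i. f i ` {..<k i}) A x = A (\<lambda>i\<in>{..<d}. f i (x i))"
    by (simp add: submatrix_def)
  have "(\<lambda>i\<in>{..<d}. f i (x i)) \<in> positions d m"
    using xk range unfolding positions_def by (auto simp: PiE_iff)
  then show "submatrix d (\<lambda>i. f i ` {..<k i}) A x = P x \<or>
      submatrix d (\<lambda>i. f i ` {..<k i}) A x = 1 \<and> P x = 0"
    using zero_one_matricesD[OF A] zero_one_matricesD[OF P x] ones[OF x] unfolding sub by metis
next
  fix i assume "i < d"
  then show "card (f i ` {..<k i}) = k i"
    using strict_mono_on_imp_inj_on[OF mono] by (simp add: card_image)
qed (use range in auto)

section \<open>Counting exceptional points\<close>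

text \<open>Two distinct bad points on one line in direction \<open>v\<close> cannot agree modulo
  \<open>K\<close>: their distance would be a positive multiple of \<open>K\<close>, making one the
  far point of the other. So each line has at most \<open>K\<close> bad points.\<close>

lemma card_direction_bad:
  fixes v :: "nat \<Rightarrow> int"
  assumes B: "B \<subseteq> positions d (\<lambda>_. n)" and K: "K > 0" and v: "\<And>i. i < d \<Longrightarrow> v i \<in> {-1, 0, 1}"
  shows "card {m \<in> B. \<not> (\<exists>q\<in>B. \<exists>t\<ge>K. \<forall>i<d. int (q i) = int (m i) + int t * v i)}
    \<le> K * (3 * n) ^ (d - 1)" (is "card ?D \<le> _")
proof (cases "\<exists>i0<d. v i0 \<noteq> 0")
  case False
  \<comment> \<open>For the zero direction, \<open>m\<close> itself with \<open>t = K\<close> is a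
    far point.\<close>
  then have "?D = {}" by auto
  then show ?thesis by (metis card.empty zero_le)
next
  case True
  then obtain i0 where i0: "i0 < d" "v i0 \<noteq> 0" by auto
  then have vv: "v i0 * v i0 = 1" using v[of i0] by auto
  have Bn: "m i < n" if "m \<in> B" "i < d" for m i
    using B that by (auto simp: positions_def)
  \<comment> \<open>The first component identifies the line through \<open>m\<close> in direction \<open>v\<close>.\<close>
  define h where
    "h m = ((\<lambda>i\<in>{..<d}-{i0}. int (m i) - v i * v i0 * int (m i0)), m i0 mod K)" for m :: "nat \<Rightarrow> nat"
  \<comment> \<open>The signed number of steps from \<open>m\<close> to \<open>m'\<close> along
    \<open>v\<close>: since \<open>v i0\<close> is 1 or -1, multiplying by it amounts to dividing by
    it.\<close>
  define T where "T m m' = v i0 * (int (m' i0) - int (m i0))" for m m' :: "nat \<Rightarrow> nat"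
  have line: "int (m' i) = int (m i) + T m m' * v i" if "h m = h m'" "i < d" for m m' i
  proof (cases "i = i0")
    case True
    have "T m m' * v i0 = (v i0 * v i0) * (int (m' i0) - int (m i0))"
      by (simp add: T_def)
    then show ?thesis using True vv by simp
  next
    case False
    then have "int (m i) - v i * v i0 * int (m i0) = int (m' i) - v i * v i0 * int (m' i0)"
      using that by (auto simp: h_def dest: fun_cong[of _ _ i])
    then show ?thesis by (simp add: T_def algebra_simps)
  qed
  \<comment> \<open>Equal residues make \<open>T m m'\<close> a multiple of \<open>K\<close>; if
    positive, it is at least \<open>K\<close>, and \<open>m'\<close> shows that \<open>m\<close> is
    not bad. Exchanging the two points then forces \<open>T m m' = 0\<close>.\<close>
  have le: "T m m' \<le> 0" if "m \<in> ?D" "m' \<in> ?D" "h m = h m'" for m m'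
  proof (rule ccontr)
    assume neg: "\<not> T m m' \<le> 0"
    have "int (m' i0) mod int K = int (m i0) mod int K"
      using that by (simp add: h_def flip: of_nat_mod)
    then have "int K dvd T m m'"
      unfolding T_def by (simp add: mod_eq_dvd_iff)
    then have "int K \<le> T m m'" using neg by (simp add: zdvd_imp_le)
    then have "nat (T m m') \<ge> K \<and> (\<forall>i<d. int (m' i) = int (m i) + int (nat (T m m')) * v i)"
      using line[OF that(3)] by auto
    then show False using that by blast
  qed
  have "inj_on h ?D"
  proof (rule inj_onI)
    fix m m' assume mm: "m \<in> ?D" "m' \<in> ?D" and h: "h m = h m'"
    have "T m' m = - T m m'" by (simp add: T_def algebra_simps)
    then have "T m m' = 0" using le[OF mm h] le[OF mm(2,1) h[symmetric]] by simp
    then have "m i = m' i" if "i < d" for i using line[OF h that] by simp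
    moreover have "m \<in> positions d (\<lambda>_. n)" "m' \<in> positions d (\<lambda>_. n)" using mm B by auto
    ultimately show "m = m'" unfolding positions_def by (intro PiE_ext) auto
  qed
  moreover have "h ` ?D \<subseteq> (\<Pi>\<^sub>E i\<in>{..<d}-{i0}. {- int n..<2 * int n}) \<times> {..<K}"
  proof -
    have "int (m i) - v i * v i0 * int (m i0) \<in> {- int n..<2 * int n}"
      if "m \<in> B" "i < d" for m i
      using Bn[OF that] Bn[OF that(1) i0(1)] v[OF that(2)] v[OF i0(1)] by auto
    then show ?thesis using K by (simp add: h_def image_subset_iff restrict_PiE_iff)
  qed
  ultimately have "card ?D \<le> card ((\<Pi>\<^sub>E i\<in>{..<d}-{i0}. {- int n..<2 * int n}) \<times> {..<K})"
    by (intro card_inj_on_le[of h]) (auto intro!: finite_PiE)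
  also have "\<dots> = K * (3 * n) ^ (d - 1)"
    using i0 by (simp add: card_cartesian_product card_PiE nat_mult_distrib)
  finally show ?thesis .
qed

lemma card_positions_slab:
  assumes "i < d"
  shows "card {x \<in> positions d (\<lambda>_. n). x i \<in> L} \<le> card ({..<n} \<inter> L) * n ^ (d - 1)"
proof -
  have "{x \<in> positions d (\<lambda>_. n). x i \<in> L}
      \<subseteq> (\<Pi>\<^sub>E j\<in>{..<d}. if j = i then {..<n} \<inter> L else {..<n})"
    using assms by (auto simp: positions_def PiE_def)
  then have "card {x \<in> positions d (\<lambda>_. n). x i \<in> L}
      \<le> card (\<Pi>\<^sub>E j\<in>{..<d}. if j = i then {..<n} \<inter> L else {..<n})"
    by (intro card_mono finite_PiE) auto
  also have "\<dots> = (\<Prod>j\<in>{..<d}. if j = i then card ({..<n} \<inter> L) else n)"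
    by (simp add: card_PiE if_distrib cong: if_cong)
  also have "\<dots> = card ({..<n} \<inter> L) * (\<Prod>j\<in>{..<d} - {i}. if j = i then card ({..<n} \<inter> L) else n)"
    using assms by (subst prod.remove[of _ i]) auto
  also have "(\<Prod>j\<in>{..<d} - {i}. if j = i then card ({..<n} \<inter> L) else n) = n ^ (d - 1)"
    using assms by (subst prod.cong[OF refl, of _ _ "\<lambda>_. n"]) auto
  finally show ?thesis .
qed

lemma card_positions_boundary:
  "card {x \<in> positions d (\<lambda>_. n). \<exists>i<d. \<not> (K \<le> x i \<and> x i + K \<le> n)} \<le> d * (2 * K * n ^ (d - 1))"
proof -
  define L where "L = {x. \<not> (K \<le> x \<and> x + K \<le> n)}"
  have "{..<n} \<inter> L \<subseteq> {..<K} \<union> {n - K..<n}" by (auto simp: L_def)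
  then have "card ({..<n} \<inter> L) \<le> card ({..<K} \<union> {n - K..<n})" by (intro card_mono) auto
  also have "\<dots> \<le> 2 * K" by (rule order_trans[OF card_Un_le]) simp
  finally have L: "card ({..<n} \<inter> L) \<le> 2 * K" .
  have "{x \<in> positions d (\<lambda>_. n). \<exists>i<d. \<not> (K \<le> x i \<and> x i + K \<le> n)}
      = (\<Union>i\<in>{..<d}. {x \<in> positions d (\<lambda>_. n). x i \<in> L})"
    by (auto simp: L_def)
  also have "card \<dots> \<le> (\<Sum>i\<in>{..<d}. card {x \<in> positions d (\<lambda>_. n). x i \<in> L})"
    by (rule card_UN_le) simp
  also have "\<dots> \<le> (\<Sum>i\<in>{..<d}. 2 * K * n ^ (d - 1))"
    using L by (intro sum_mono order_trans[OF card_positions_slab] mult_right_mono) auto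
  finally show ?thesis by simp
qed

section \<open>Finding the pattern in a dense matrix\<close>

text \<open>The weak inequalities also cover ties: if two of the values agree, applying the property
  in both orders shows that both equal \<open>c\<close>.\<close>

lemma median_of_three:
  fixes a :: "nat \<Rightarrow> nat"
  shows "\<exists>c. \<forall>j<3. \<forall>l<3. j \<noteq> l \<longrightarrow> a j \<le> a l \<longrightarrow> a j \<le> c \<and> c \<le> a l"
proof -
  define c where "c = max (min (a 0) (a 1)) (min (max (a 0) (a 1)) (a 2))"
  have "a j \<le> c \<and> c \<le> a l" if "j < 3" "l < 3" "j \<noteq> l" "a j \<le> a l" for j l
  proof -
    have "j \<in> {0, 1, 2}" "l \<in> {0, 1, 2}" using that by auto
    then show ?thesis using that(3,4) by (auto simp: c_def max_def min_def)
  qed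
  then show ?thesis by blast
qed

text \<open>The \<open>p j\<close> only have to cover the ones of \<open>P\<close>, so patterns with
  fewer ones are padded with repeated or arbitrary positions. In the constant,
  \<open>2 * d * K\<close> pays for points near the boundary and the other summand for the bad
  points of three directions.\<close>

lemma num_ones_le_if_not_contains:
  assumes A: "A \<in> zero_one_matrices d (\<lambda>_. n)" and P: "P \<in> zero_one_matrices d k"
    and p: "\<And>j. j < 3 \<Longrightarrow> p j \<in> positions d k"
    and ones: "{x \<in> positions d k. P x = 1} \<subseteq> p ` {..<3::nat}"
    and K: "K > 0" "\<And>i. i < d \<Longrightarrow> k i \<le> K"
    and avoid: "\<not> contains d (\<lambda>_. n) A k P"
  shows "num_ones d (\<lambda>_. n) A \<le> (2 * d * K + 3 * K * 3 ^ (d - 1)) * n ^ (d - 1)"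
proof -
  obtain c where c:
    "\<And>i j l. j < 3 \<Longrightarrow> l < 3 \<Longrightarrow> j \<noteq> l \<Longrightarrow> p j i \<le> p l i \<Longrightarrow> p j i \<le> c i \<and> c i \<le> p l i"
    using median_of_three[of "\<lambda>j. p j i" for i] by metis
  define v where "v j i = sgn (int (p j i) - int (c i))" for j i
  \<comment> \<open>Discarding \<open>R\<close> gives all far points \<open>q j\<close> the margins
    required by \<open>strict_mono_on_extension\<close>.\<close>
  define R where "R = {x \<in> positions d (\<lambda>_. n). \<exists>i<d. \<not> (K \<le> x i \<and> x i + K \<le> n)}"
  define B where "B = {x \<in> positions d (\<lambda>_. n). A x = 1} - R"
  define D where
    "D j = {m \<in> B. \<not> (\<exists>q\<in>B. \<exists>t\<ge>K. \<forall>i<d. int (q i) = int (m i) + int t * v j i)}" for j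
  have cardD: "card (D j) \<le> K * (3 * n) ^ (d - 1)" for j
    unfolding D_def
    by (rule card_direction_bad) (use K in \<open>auto simp: B_def v_def sgn_if\<close>)
  \<comment> \<open>A point of \<open>B\<close> that is bad for none of the three directions has far
    points \<open>q 0\<close>, \<open>q 1\<close>, \<open>q 2\<close> in \<open>B\<close>, and
    mapping each \<open>p j\<close> to \<open>q j\<close> embeds \<open>P\<close>.\<close>
  have "B \<subseteq> (\<Union>j<3. D j)"
  proof (rule ccontr)
    assume "\<not> B \<subseteq> (\<Union>j<3. D j)"
    then obtain m where "m \<in> B" "\<forall>j<3. m \<notin> D j" by auto
    then have "\<forall>j<3. \<exists>q t. q \<in> B \<and> t \<ge> K \<and> (\<forall>i<d. int (q i) = int (m i) + int t * v j i)"
      unfolding D_def by blast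
    then obtain q t where q: "\<And>j. j < 3 \<Longrightarrow> q j \<in> B" and t: "\<And>j. j < 3 \<Longrightarrow> t j \<ge> K"
      and qt: "\<And>j i. j < 3 \<Longrightarrow> i < d \<Longrightarrow> int (q j i) = int (m i) + int (t j) * v j i"
      by metis
    have "\<exists>f. strict_mono_on {..<k i} f \<and> f ` {..<k i} \<subseteq> {..<n} \<and> (\<forall>j<3. f (p j i) = q j i)"
      if i: "i < d" for i
    proof (rule strict_mono_on_extension[of "{..<3}" "\<lambda>j. p j i" "\<lambda>j. q j i" "k i" n])
      fix j l :: nat assume jl: "j \<in> {..<3}" "l \<in> {..<3}"
      show "q j i = q l i" if "p j i = p l i"
      proof (cases "j = l")
        case False
        \<comment> \<open>Both directions vanish in coordinate \<open>i\<close>, so both far points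
          keep the coordinate \<open>m i\<close>.\<close>
        then have "p j i = c i" "p l i = c i" using c[of j l i] c[of l j i] jl that by auto
        then show ?thesis using qt[of j i] qt[of l i] jl i by (simp add: v_def)
      qed simp
      show "q j i + k i \<le> q l i" if less: "p j i < p l i"
      proof -
        \<comment> \<open>Point \<open>j\<close> does not move up and point \<open>l\<close> does
          not move down, and at least one of them moves, by at least \<open>K\<close>. This holds
          even though the step counts \<open>t j\<close> and \<open>t l\<close> are
          unrelated.\<close>
        have "j \<noteq> l" using less by auto
        then have "p j i \<le> c i" "c i \<le> p l i" using c[of j l i] jl less by auto
        then have "v j i \<le> 0" "v l i \<ge> 0" "v j i = -1 \<or> v l i = 1"
          "v j i \<in> {-1, 0, 1}" "v l i \<in> {-1, 0, 1}"
          using less by (auto simp: v_def sgn_if)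
        then have "int (q j i) + int K \<le> int (q l i)"
          using qt[of j i] qt[of l i] jl i t[of j] t[of l] by auto
        then show ?thesis using K(2)[OF i] by linarith
      qed
    next
      fix j :: nat assume "j \<in> {..<3}"
      then have "q j \<in> positions d (\<lambda>_. n) - R" using q by (auto simp: B_def)
      then show "k i \<le> q j i \<and> q j i + k i \<le> n"
        using i K(2)[OF i] by (fastforce simp: R_def)
    qed (auto simp: lessThan_empty_iff)
    then obtain f where f: "\<And>i. i < d \<Longrightarrow> strict_mono_on {..<k i} (f i)"
      "\<And>i. i < d \<Longrightarrow> f i ` {..<k i} \<subseteq> {..<n}"
      "\<And>i j. i < d \<Longrightarrow> j < 3 \<Longrightarrow> f i (p j i) = q j i"
      by metis
    have "contains d (\<lambda>_. n) A k P"
    proof (rule containsI[OF _ _ A P])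
      fix x assume "x \<in> positions d k" "P x = 1"
      then obtain j where j: "j < 3" "x = p j" using ones by auto
      have "q j \<in> positions d (\<lambda>_. n)" "A (q j) = 1" using q[OF j(1)] by (auto simp: B_def)
      moreover have "(\<lambda>i\<in>{..<d}. f i (x i)) = q j"
        using calculation(1) f(3) j by (intro extensionalityI[of _ "{..<d}"]) (auto simp: positions_def PiE_def)
      ultimately show "A (\<lambda>i\<in>{..<d}. f i (x i)) = 1" by simp
    qed (use f in auto)
    then show False using avoid by simp
  qed
  then have sub: "{x \<in> positions d (\<lambda>_. n). A x = 1} \<subseteq> R \<union> (\<Union>j<3. D j)"
    by (auto simp: B_def)
  have finR: "finite R" and finD: "finite (D j)" for j
    by (auto simp: R_def D_def B_def finite_positions)
  have "num_ones d (\<lambda>_. n) A \<le> card (R \<union> (\<Union>j<3. D j))"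
    unfolding num_ones_def using sub finR finD by (intro card_mono) auto
  also have "\<dots> \<le> card R + card (\<Union>j<3. D j)" by (rule card_Un_le)
  also have "\<dots> \<le> d * (2 * K * n ^ (d - 1)) + (\<Sum>j<3. card (D j))"
    unfolding R_def by (intro add_mono card_positions_boundary card_UN_le) simp
  also have "(\<Sum>j<3. card (D j)) \<le> (\<Sum>j<3::nat. K * (3 * n) ^ (d - 1))"
    by (intro sum_mono cardD)
  finally show ?thesis by (simp add: algebra_simps power_mult_distrib)
qed

lemma extremal_number_le:
  assumes "\<And>A. A \<in> zero_one_matrices d (\<lambda>_. n) \<Longrightarrow> \<not> contains d (\<lambda>_. n) A k P
    \<Longrightarrow> num_ones d (\<lambda>_. n) A \<le> N"
  shows "extremal_number d k P n \<le> N"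
proof -
  define W where "W = {num_ones d (\<lambda>_. n) A | A.
    A \<in> zero_one_matrices d (\<lambda>_. n) \<and> \<not> contains d (\<lambda>_. n) A k P}"
  have "W \<subseteq> {..N}" using assms by (auto simp: W_def)
  moreover from this have "finite W" by (rule finite_subset) simp
  ultimately have "(if W = {} then 0 else Max W) \<le> N" by auto
  then show ?thesis by (simp only: extremal_number_def W_def Let_def)
qed

theorem lemma3p16:
  fixes d :: nat and k :: "nat \<Rightarrow> nat" and P :: "(nat \<Rightarrow> nat) \<Rightarrow> nat"
  assumes "d \<ge> 1"
    and "P \<in> zero_one_matrices d k"
    and "num_ones d k P \<le> 3"
  shows "(\<lambda>n::nat. real (extremal_number d k P n)) \<in> O(\<lambda>n. real n ^ (d - 1))"
proof -
  \<comment> \<open>A positive common bound for all side lengths of \<open>P\<close>.\<close>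
  define K where "K = Suc (\<Sum>i<d. k i)"
  have K: "k i \<le> K" if "i < d" for i
    using member_le_sum[of i "{..<d}" k] that by (simp add: K_def)
  define C where "C = 2 * d * K + 3 * K * 3 ^ (d - 1)"
  have bound: "extremal_number d k P n \<le> C * n ^ (d - 1)" if n: "n \<ge> K" for n
  proof (rule extremal_number_le)
    fix A assume A: "A \<in> zero_one_matrices d (\<lambda>_. n)" "\<not> contains d (\<lambda>_. n) A k P"
    \<comment> \<open>A pattern without entries is contained in every matrix with
      \<open>n \<ge> K\<close>, via identity maps. Otherwise some position \<open>x0\<close> is
      available for padding.\<close>
    have "positions d k \<noteq> {}"
    proof
      assume "positions d k = {}"
      then have "contains d (\<lambda>_. n) A k P"
        using K n by (intro containsI[OF _ _ A(1) assms(2), of "\<lambda>_ x. x"])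
          (fastforce simp: strict_mono_on_def)+
      then show False using A by simp
    qed
    then obtain x0 where x0: "x0 \<in> positions d k" by auto
    let ?X = "{x \<in> positions d k. P x = 1}"
    have "finite ?X" using finite_positions by simp
    then obtain h where h: "bij_betw h {0..<card ?X} ?X"
      using ex_bij_betw_nat_finite by blast
    define p where "p j = (if j < card ?X then h j else x0)" for j
    have "p j \<in> positions d k" for j
      using bij_betwE[OF h] x0 by (auto simp: p_def)
    moreover have "?X \<subseteq> p ` {..<3}"
    proof
      fix x assume "x \<in> ?X"
      then obtain j where "j < card ?X" "x = h j"
        using bij_betw_imp_surj_on[OF h] by force
      then show "x \<in> p ` {..<3}"
        using assms(3) by (intro image_eqI[of _ _ j]) (auto simp: p_def num_ones_def)
    qed
    ultimately show "num_ones d (\<lambda>_. n) A \<le> C * n ^ (d - 1)"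
      unfolding C_def using K A
      by (intro num_ones_le_if_not_contains[OF A(1) assms(2)]) (auto simp: K_def)
  qed
  have "norm (real (extremal_number d k P n)) \<le> real C * norm (real n ^ (d - 1))" if "n \<ge> K" for n
    using of_nat_mono[OF bound[OF that], where 'a = real] by simp
  then show ?thesis
    by (intro bigoI[of _ "real C"] eventually_sequentiallyI[of K])
qed

end
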